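(* Let $0<\lambda\le \pi/2$ and let $f\in\mathcal{S}^*_{\lambda e}$. Then the pre-Schwarzian norm of $f$ satisfies $$\|P_f\|\le \frac{(1-\alpha^2)(e^{\lambda\alpha}+\lambda\alpha-1)}{\alpha},$$ where $\alpha$ is the unique root in $(0,1)$ of the equation $$1+r^2-2\lambda r^3-e^{\lambda r}(1-\lambda r+r^2+\lambda r^3)=0.$$ The inequality is sharp, i.e. equality holds for some function in $\mathcal{S}^*_{\lambda e}$.
   Context: $\mathbb{D}=\{z\in\mathbb{C}:|z|<1\}$. $\mathcal{A}$ is the class of analytic functions $f$ on $\mathbb{D}$ with $f(0)=0$ and $f'(0)=1$. For $F,G$ analytic on $\mathbb{D}$, $F\prec G$ ($F$ is subordinate to $G$) means there is an analytic $\omega:\mathbb{D}\to\mathbb{D}$ with $\omega(0)=0$ and $F(z)=G(\omega(z))$ for all $z\in\mathbb{D}$. For $0<\lambda\le\pi/2$, $$\mathcal{S}^*_{\lambda e}=\left\{f\in\mathcal{A}:\frac{zf'(z)}{f(z)}\prec e^{\lambda z}\right\},$$ where $zf'(z)/f(z)$ is understood to take the value $1$ at $z=0$. For a locally univalent analytic $f$ on $\mathbb{D}$ (i.e. $f'(z)\neq0$ for all $z\in\mathbb{D}$), $P_f(z)=f''(z)/f'(z)$ is the pre-Schwarzian derivative and $\|P_f\|=\sup_{z\in\mathbb{D}}(1-|z|^2)|P_f(z)|$ is the pre-Schwarzian norm. *)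

theory Defs
  imports "HOL-Complex_Analysis.Complex_Analysis" "HOL-Library.Extended_Real"
begin

text \<open>
  Functions on the unit disc are total functions on the complex plane; only their values on
  \<^term>\<open>ball 0 1 :: complex set\<close> matter below, since the disc is open.
\<close>

abbreviation unit_disc :: "complex set" where
  "unit_disc \<equiv> ball 0 1"

definition class_A :: "(complex \<Rightarrow> complex) set" where
  "class_A = {f. f holomorphic_on unit_disc \<and> f 0 = 0 \<and> deriv f 0 = 1}"

definition subordinate :: "(complex \<Rightarrow> complex) \<Rightarrow> (complex \<Rightarrow> complex) \<Rightarrow> bool" where
  "subordinate F G \<longleftrightarrow>
     F holomorphic_on unit_disc \<and> G holomorphic_on unit_disc \<and>
     (\<exists>\<omega>. \<omega> holomorphic_on unit_disc \<and> \<omega> ` unit_disc \<subseteq> unit_disc \<and> \<omega> 0 = 0 \<and>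
          (\<forall>z\<in>unit_disc. F z = G (\<omega> z)))"

text \<open>
  No separate condition that \<open>f\<close> is nonzero off the origin is needed below: at such a zero the quotient
  \<open>z * deriv f z / f z\<close> would be \<open>0\<close> in HOL, which is not a value of the exponential function.
\<close>

definition starlike_exp :: "real \<Rightarrow> (complex \<Rightarrow> complex) set" where
  "starlike_exp lam =
     {f \<in> class_A.
        subordinate (\<lambda>z. if z = 0 then 1 else z * deriv f z / f z)
                    (\<lambda>z. exp (of_real lam * z))}"

definition pre_schwarzian :: "(complex \<Rightarrow> complex) \<Rightarrow> complex \<Rightarrow> complex" where
  "pre_schwarzian f z = deriv (deriv f) z / deriv f z"

text \<open>
  The supremum is taken in the extended reals, so that it is infinite when the set of values is
  unbounded. The definition is meant for locally univalent \<open>f\<close>; the lemma below shows that this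
  covers all members of \<^const>\<open>starlike_exp\<close>.
\<close>

definition pre_schwarzian_norm :: "(complex \<Rightarrow> complex) \<Rightarrow> ereal" where
  "pre_schwarzian_norm f =
     (SUP z\<in>unit_disc. ereal ((1 - (cmod z)\<^sup>2) * cmod (pre_schwarzian f z)))"

lemma starlike_exp_nonzero:
  assumes "f \<in> starlike_exp lam" and "z \<in> unit_disc"
  shows "deriv f z \<noteq> 0" and "z \<noteq> 0 \<Longrightarrow> f z \<noteq> 0"
proof -
  have d0: "deriv f 0 = 1"
    using assms(1) by (simp add: starlike_exp_def class_A_def)
  obtain \<omega> where "\<forall>z\<in>unit_disc. (if z = 0 then 1 else z * deriv f z / f z) = exp (of_real lam * \<omega> z)"
    using assms(1) unfolding starlike_exp_def subordinate_def by blast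
  then have *: "z * deriv f z / f z \<noteq> 0" if "z \<noteq> 0"
    using that assms(2) by (metis exp_not_eq_zero)
  show "deriv f z \<noteq> 0"
    using d0 * by (cases "z = 0") auto
  show "f z \<noteq> 0" if "z \<noteq> 0"
    using *[OF that] by auto
qed

end

theory Submission
  imports Defs
begin

text \<open>
  If \<open>z f'(z) / f(z) = exp (\<lambda> \<omega>(z))\<close>, then
  \<open>P\<^sub>f(z) = (exp (\<lambda> \<omega>(z)) - 1) / z + \<lambda> \<omega>'(z)\<close>. With \<open>r = |z|\<close> and \<open>s = |\<omega>(z)| \<le> r\<close>,
  the Schwarz--Pick inequality bounds \<open>(1 - r\<^sup>2) |P\<^sub>f(z)|\<close> by
  \<open>(1/r - r) (exp (\<lambda> s) - 1) + \<lambda> (1 - s\<^sup>2)\<close>. This is decreasing in \<open>r\<close>, so it is at most its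
  value \<open>\<Phi>(s)\<close> at \<open>r = s\<close>. The function \<open>\<Phi>\<close> is strictly concave, and \<open>r\<^sup>2 \<Phi>'(r)\<close> is the
  left-hand side of the equation for \<open>\<alpha>\<close>, so \<open>\<Phi>\<close> is maximal at \<open>\<alpha>\<close>. The case \<open>\<omega>(z) = z\<close> attains
  the bound at \<open>z = \<alpha>\<close>.
\<close>

section \<open>Exponential estimate and the Schwarz-Pick inequality\<close>

text \<open>The exponential series without its constant term still has positive coefficients, so the
  triangle inequality applies term by term.\<close>

lemma norm_exp_minus_one_le:
  fixes z :: "'a :: {real_normed_field, banach}"
  shows "norm (exp z - 1) \<le> exp (norm z) - 1"
proof -
  let ?f = "\<lambda>n. inverse (fact (Suc n)) *\<^sub>R z ^ Suc n"
  have norm_f: "norm (?f n) = inverse (fact (Suc n)) *\<^sub>R norm z ^ Suc n" for n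
    by (simp add: norm_power norm_mult)
  have "summable (\<lambda>n. norm (?f n))"
    unfolding norm_f using summable_exp_generic[of "norm z"]
    by (subst summable_Suc_iff) (simp add: divide_inverse)
  then have "norm (\<Sum>n. ?f n) \<le> (\<Sum>n. norm (?f n))"
    by (rule summable_norm)
  moreover have "exp z - 1 = (\<Sum>n. ?f n)" "exp (norm z) - 1 = (\<Sum>n. norm (?f n))"
    unfolding norm_f using exp_first_term[of z] exp_first_term[of "norm z"] by simp_all
  ultimately show ?thesis
    by simp
qed

lemma Moebius_function_has_field_derivative:
  assumes "1 - cnj w * z \<noteq> 0"
  shows "(Moebius_function 0 w has_field_derivative
           (1 - w * cnj w) / (1 - cnj w * z)\<^sup>2) (at z)"
proof -
  have "((\<lambda>z. (z - w) / (1 - cnj w * z)) has_field_derivative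
      ((1 - 0) * (1 - cnj w * z) - (z - w) * (0 - cnj w * 1))
        / ((1 - cnj w * z) * (1 - cnj w * z))) (at z)"
    using assms by (intro derivative_intros DERIV_cmult) auto
  then show ?thesis
    unfolding Moebius_function_simple [abs_def] by (simp add: power2_eq_square algebra_simps)
qed

text \<open>Composing \<open>f\<close> with disc automorphisms sending 0 to \<open>z\<close> and
  \<open>f z\<close> to 0 gives a self-map \<open>g\<close> of the disc fixing 0. The Schwarz lemma
  yields \<open>cmod (deriv g 0) \<le> 1\<close>, which the chain rule turns into the claim.\<close>

lemma Schwarz_Pick:
  assumes holo: "f holomorphic_on ball 0 1"
    and maps: "f ` ball 0 1 \<subseteq> ball 0 1"
    and z: "z \<in> ball 0 1"
  shows "(1 - (cmod z)\<^sup>2) * cmod (deriv f z) \<le> 1 - (cmod (f z))\<^sup>2"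
proof -
  define w where "w = f z"
  have "w \<in> ball 0 1"
    unfolding w_def using maps z by blast
  then have nz: "cmod z < 1" and nw: "cmod w < 1"
    using z by simp_all
  then have pz: "0 < 1 - (cmod z)\<^sup>2" and pw: "0 < 1 - (cmod w)\<^sup>2"
    by (simp_all add: abs_square_less_1)
  define g where "g = Moebius_function 0 w \<circ> (f \<circ> Moebius_function 0 (- z))"
  have M: "Moebius_function 0 (- z) ` ball 0 1 \<subseteq> ball 0 1"
    using Moebius_function_norm_lt_1[of "- z"] nz by auto
  have "g holomorphic_on ball 0 1"
    unfolding g_def
  proof (intro holomorphic_on_compose_gen[of _ _ _ "ball 0 1"])
    show "(f \<circ> Moebius_function 0 (- z)) ` ball 0 1 \<subseteq> ball 0 1"
      using M maps by fastforce
  qed (use nz nw holo M in \<open>auto intro: Moebius_function_holomorphic\<close>)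
  moreover have "g 0 = 0"
    by (simp add: g_def w_def Moebius_function_of_zero Moebius_function_eq_zero)
  moreover have "cmod (g u) < 1" if "cmod u < 1" for u
  proof -
    have "Moebius_function 0 (- z) u \<in> ball 0 1"
      using M that by (simp add: image_subset_iff)
    then have "f (Moebius_function 0 (- z) u) \<in> ball 0 1"
      using maps by blast
    then show ?thesis
      using nw by (simp add: g_def Moebius_function_norm_lt_1)
  qed
  ultimately have g': "cmod (deriv g 0) \<le> 1"
    by (rule Schwarz_Lemma(2)[where \<xi> = 0]) auto
  have sq: "u * cnj u = of_real ((cmod u)\<^sup>2)" for u
    by (simp add: complex_norm_square del: of_real_power)
  have "(Moebius_function 0 (- z) has_field_derivative of_real (1 - (cmod z)\<^sup>2)) (at 0)"
    using Moebius_function_has_field_derivative[of "- z" 0] by (simp add: sq)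
  moreover have "(f has_field_derivative deriv f z) (at (Moebius_function 0 (- z) 0))"
    using holomorphic_derivI[OF holo _ z] by (simp add: Moebius_function_of_zero)
  ultimately have "(f \<circ> Moebius_function 0 (- z) has_field_derivative
      deriv f z * of_real (1 - (cmod z)\<^sup>2)) (at 0)"
    by (rule DERIV_chain[rotated])
  moreover have "(Moebius_function 0 w has_field_derivative inverse (of_real (1 - (cmod w)\<^sup>2)))
      (at ((f \<circ> Moebius_function 0 (- z)) 0))"
  proof -
    have eq: "1 - cnj w * w = of_real (1 - (cmod w)\<^sup>2)"
      by (simp add: sq mult.commute[of "cnj w"])
    have ne: "1 - cnj w * w \<noteq> 0"
      unfolding eq of_real_eq_0_iff using pw by simp
    \<comment> \<open>This includes \<open>x = 0\<close>, where both sides are 0 by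
      convention.\<close>
    have "x / x\<^sup>2 = inverse x" for x :: complex
      by (simp add: power2_eq_square field_simps)
    then have "(1 - w * cnj w) / (1 - cnj w * w)\<^sup>2 = inverse (of_real (1 - (cmod w)\<^sup>2))"
      unfolding mult.commute[of w "cnj w"] eq .
    moreover have "(f \<circ> Moebius_function 0 (- z)) 0 = w"
      by (simp add: w_def Moebius_function_of_zero)
    ultimately show ?thesis
      using Moebius_function_has_field_derivative[OF ne] by simp
  qed
  ultimately have "(g has_field_derivative
      inverse (of_real (1 - (cmod w)\<^sup>2)) * (deriv f z * of_real (1 - (cmod z)\<^sup>2))) (at 0)"
    unfolding g_def by (rule DERIV_chain[rotated])
  then have "deriv g 0 =
      inverse (of_real (1 - (cmod w)\<^sup>2)) * (deriv f z * of_real (1 - (cmod z)\<^sup>2))"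
    by (rule DERIV_imp_deriv)
  then have "cmod (deriv g 0) = cmod (deriv f z) * (1 - (cmod z)\<^sup>2) / (1 - (cmod w)\<^sup>2)"
    using pz pw by (simp add: norm_mult norm_inverse divide_inverse mult.commute
        del: of_real_diff of_real_power)
  then show ?thesis
    using g' pw by (simp add: w_def field_simps)
qed

section \<open>The one-variable extremal problem\<close>

text \<open>This is \<Phi> from the overview, with the factor \<open>(1 - r\<^sup>2) / r\<close>
  pulled out.\<close>

definition bound_fun :: "real \<Rightarrow> real \<Rightarrow> real" where
  "bound_fun lam r = (1 - r\<^sup>2) * (exp (lam * r) + lam * r - 1) / r"

definition critical_fun :: "real \<Rightarrow> real \<Rightarrow> real" where
  "critical_fun lam r =
     1 + r^2 - 2 * lam * r^3 - exp (lam * r) * (1 - lam * r + r^2 + lam * r^3)"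

lemma bound_fun_has_real_derivative:
  assumes "r \<noteq> 0"
  shows "(bound_fun lam has_real_derivative critical_fun lam r / r\<^sup>2) (at r)"
proof -
  let ?e = "exp (lam * r)"
  have "((\<lambda>r. (1 - r\<^sup>2) * (exp (lam * r) + lam * r - 1) / r) has_real_derivative
      (((- (2 * r)) * (?e + lam * r - 1) + (?e * lam + lam) * (1 - r\<^sup>2)) * r
        - (1 - r\<^sup>2) * (?e + lam * r - 1) * 1) / (r * r)) (at r)"
    by (rule derivative_eq_intros refl | use assms in simp)+
  moreover have "((- (2 * r)) * (?e + lam * r - 1) + (?e * lam + lam) * (1 - r\<^sup>2)) * r
        - (1 - r\<^sup>2) * (?e + lam * r - 1) * 1 = critical_fun lam r"
    unfolding critical_fun_def by algebra
  ultimately show ?thesis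
    unfolding bound_fun_def [abs_def] power2_eq_square by simp
qed

text \<open>The derivative of \<open>critical_fun\<close> has a factor \<open>r\<close>; this is the
  cofactor. Its value at 0 is \<open>lam^2\<close>, hence positive.\<close>

definition critical_slope :: "real \<Rightarrow> real \<Rightarrow> real" where
  "critical_slope lam r = 2 - 6 * lam * r - exp (lam * r) * (2 - lam^2 + 4 * lam * r + lam^2 * r^2)"

lemma critical_fun_has_real_derivative:
  "(critical_fun lam has_real_derivative r * critical_slope lam r) (at r)"
  unfolding critical_fun_def [abs_def] critical_slope_def
  by ((rule derivative_eq_intros refl)+, simp,
      simp add: algebra_simps power2_eq_square power3_eq_cube)

lemma critical_slope_has_real_derivative:
  "(critical_slope lam has_real_derivative
      - lam * (6 + exp (lam * r) * (6 - lam^2 + 6 * lam * r + lam^2 * r^2))) (at r)"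
  unfolding critical_slope_def [abs_def]
  by ((rule derivative_eq_intros refl)+, simp, simp add: algebra_simps power2_eq_square)

text \<open>The quotient below is the derivative of \<^const>\<open>bound_fun\<close>, which is thus strictly concave.\<close>

lemma critical_fun_quotient_decreasing:
  assumes "0 < lam" "lam^2 \<le> 6" "0 < r" "r < s"
  shows "critical_fun lam s / s\<^sup>2 < critical_fun lam r / r\<^sup>2"
proof -
  \<comment> \<open>The derivative of the quotient is \<open>M x / x^3\<close>. In the derivative of
    \<open>M\<close> the terms containing \<open>critical_slope\<close> itself cancel, leaving
    \<open>x\<^sup>2\<close> times the derivative of \<open>critical_slope\<close>.\<close>
  define M where "M x = x\<^sup>2 * critical_slope lam x - 2 * critical_fun lam x" for x
  have M': "(M has_real_derivative
      x\<^sup>2 * (- lam * (6 + exp (lam * x) * (6 - lam^2 + 6 * lam * x + lam^2 * x^2)))) (at x)" for x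
    unfolding M_def
    by (rule derivative_eq_intros critical_slope_has_real_derivative
        critical_fun_has_real_derivative refl)+ (simp add: algebra_simps power2_eq_square)
  have M_neg: "M x < 0" if "0 < x" for x
  proof -
    have "M x < M 0"
    proof (rule DERIV_neg_imp_decreasing_open[OF that])
      fix y :: real assume "0 < y"
      \<comment> \<open>Here \<open>lam^2 \<le> 6\<close> makes the constant part of the bracket
        nonnegative.\<close>
      then have "0 \<le> exp (lam * y) * (6 - lam^2 + 6 * lam * y + lam^2 * y^2)"
        using assms by (intro mult_nonneg_nonneg add_nonneg_nonneg) auto
      then have "y\<^sup>2 * (- lam * (6 + exp (lam * y) * (6 - lam^2 + 6 * lam * y + lam^2 * y^2))) < 0"
        using \<open>0 < y\<close> \<open>0 < lam\<close> by (simp add: mult_pos_pos mult_less_0_iff)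
      then show "\<exists>D. DERIV M y :> D \<and> D < 0"
        using M' by blast
    next
      show "continuous_on {0..x} M"
        by (intro continuous_at_imp_continuous_on ballI DERIV_isCont[OF M'])
    qed
    then show ?thesis
      by (simp add: M_def critical_fun_def)
  qed
  show ?thesis
  proof (rule DERIV_neg_imp_decreasing[OF \<open>r < s\<close>])
    fix x assume "r \<le> x"
    then have x: "0 < x"
      using \<open>0 < r\<close> by simp
    have "((\<lambda>x. critical_fun lam x / x\<^sup>2) has_real_derivative M x / x^3) (at x)"
      using x by (auto intro!: derivative_eq_intros critical_fun_has_real_derivative
          simp: M_def field_simps power2_eq_square power3_eq_cube)
    moreover have "M x / x^3 < 0"
      using x M_neg by (simp add: divide_neg_pos)
    ultimately show "\<exists>y. ((\<lambda>x. critical_fun lam x / x\<^sup>2) has_real_derivative y) (at x) \<and> y < 0"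
      by blast
  qed
qed

text \<open>Supplies the left end of a sign change. At 0 both \<open>critical_fun\<close> and its
  derivative vanish, so the sign comes from \<open>critical_slope\<close>, which stays positive near
  0 by continuity.\<close>

lemma critical_fun_pos_near_0:
  assumes "0 < lam"
  obtains d where "0 < d" "d < 1" "0 < critical_fun lam d"
proof -
  have "isCont (critical_slope lam) 0"
    using critical_slope_has_real_derivative DERIV_isCont by blast
  moreover have "0 < critical_slope lam 0"
    using assms by (simp add: critical_slope_def)
  ultimately have "eventually (\<lambda>x. 0 < critical_slope lam x) (at 0)"
    unfolding isCont_def by (rule order_tendstoD)
  then obtain e where e: "0 < e" "\<And>x. x \<noteq> 0 \<Longrightarrow> dist x 0 < e \<Longrightarrow> 0 < critical_slope lam x"
    unfolding eventually_at by blast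
  define d where "d = min (e / 2) (1 / 2)"
  have d: "0 < d" "d < 1" "d < e"
    using e(1) by (auto simp: d_def)
  have "critical_fun lam 0 < critical_fun lam d"
  proof (rule DERIV_pos_imp_increasing_open[OF \<open>0 < d\<close>])
    fix x assume "0 < x" "x < d"
    then have "0 < x * critical_slope lam x"
      using e(2)[of x] d by simp
    then show "\<exists>y. DERIV (critical_fun lam) x :> y \<and> y > 0"
      using critical_fun_has_real_derivative by blast
  next
    show "continuous_on {0..d} (critical_fun lam)"
      by (intro continuous_at_imp_continuous_on ballI
          DERIV_isCont[OF critical_fun_has_real_derivative])
  qed
  then show ?thesis
    using that d by (simp add: critical_fun_def)
qed

text \<open>The intermediate value theorem gives a root. Since
  \<open>critical_fun lam r / r\<^sup>2\<close> is strictly decreasing, it is positive before the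
  root and negative after it: the root is unique, and \<open>bound_fun\<close> rises up to it and
  then falls.\<close>

lemma critical_point:
  assumes "0 < lam" "lam^2 \<le> 6"
  obtains \<alpha> where "\<alpha> \<in> {0<..<1}"
    "\<And>r. r \<in> {0<..<1} \<Longrightarrow> critical_fun lam r = 0 \<longleftrightarrow> r = \<alpha>"
    "\<And>r. r \<in> {0<..<1} \<Longrightarrow> bound_fun lam r \<le> bound_fun lam \<alpha>"
proof -
  obtain d where d: "0 < d" "d < 1" "0 < critical_fun lam d"
    using critical_fun_pos_near_0 assms(1) .
  \<comment> \<open>At 1 the value is \<open>2 - 2 * lam - 2 * exp lam\<close>.\<close>
  have neg: "critical_fun lam 1 < 0"
    using assms by (simp add: critical_fun_def add_pos_pos) (smt (verit) one_less_exp_iff)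
  have "\<exists>\<alpha>\<ge>d. \<alpha> \<le> 1 \<and> critical_fun lam \<alpha> = 0"
    using d neg DERIV_isCont[OF critical_fun_has_real_derivative] by (intro IVT2) auto
  then obtain \<alpha> where "d \<le> \<alpha>" "\<alpha> \<le> 1" and root: "critical_fun lam \<alpha> = 0"
    by blast
  then have \<alpha>: "0 < \<alpha>" "\<alpha> < 1"
    using d neg by (auto simp: less_le)
  have left: "0 < critical_fun lam r" if "0 < r" "r < \<alpha>" for r
    using critical_fun_quotient_decreasing[OF assms that] root that by (simp add: zero_less_divide_iff)
  have right: "critical_fun lam r < 0" if "\<alpha> < r" for r
    using critical_fun_quotient_decreasing[OF assms \<open>0 < \<alpha>\<close> that] root
    by (simp add: divide_less_0_iff)
  show thesis
  proof (rule that)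
    show "\<alpha> \<in> {0<..<1}"
      using \<alpha> by simp
    show "critical_fun lam r = 0 \<longleftrightarrow> r = \<alpha>" if "r \<in> {0<..<1}" for r
      using that root left[of r] right[of r] by (cases r \<alpha> rule: linorder_cases) auto
    show "bound_fun lam r \<le> bound_fun lam \<alpha>" if "r \<in> {0<..<1}" for r
    proof (cases "r \<le> \<alpha>")
      case True
      show ?thesis
      proof (rule DERIV_nonneg_imp_nondecreasing[OF True])
        fix x assume x: "r \<le> x" "x \<le> \<alpha>"
        then have "0 \<le> critical_fun lam x / x\<^sup>2"
          using left[of x] root that by (cases "x = \<alpha>") auto
        then show "\<exists>y. DERIV (bound_fun lam) x :> y \<and> y \<ge> 0"
          using bound_fun_has_real_derivative[of x] x that by force
      qed
    next
      case False
      then have "\<alpha> \<le> r"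
        by simp
      then show ?thesis
      proof (rule DERIV_nonpos_imp_nonincreasing)
        fix x assume x: "\<alpha> \<le> x" "x \<le> r"
        then have "critical_fun lam x / x\<^sup>2 \<le> 0"
          using right[of x] root \<alpha> by (cases "x = \<alpha>") (auto simp: divide_nonpos_nonneg)
        then show "\<exists>y. DERIV (bound_fun lam) x :> y \<and> y \<le> 0"
          using bound_fun_has_real_derivative[of x] x \<alpha> by force
      qed
    qed
  qed
qed

section \<open>The upper bound for every function in the class\<close>

text \<open>Lowering \<open>r\<close> to \<open>s\<close> can only increase the left-hand side,
  because \<open>1 / r - r\<close> decreases in \<open>r\<close> and its factor is nonnegative; at
  \<open>r = s\<close> the expression is \<open>bound_fun lam s\<close>.\<close>

lemma two_variable_bound:
  assumes "0 < lam" and s: "0 \<le> s" "s \<le> r" and r: "0 < r" "r < 1"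
    and B: "\<And>t. t \<in> {0<..<1} \<Longrightarrow> bound_fun lam t \<le> B"
  shows "(1 - r\<^sup>2) * ((exp (lam * s) - 1) / r) + lam * (1 - s\<^sup>2) \<le> B"
proof (cases "s = 0")
  case True
  \<comment> \<open>For \<open>s = 0\<close> the left-hand side is \<open>lam\<close>, and \<Phi>
    cannot be evaluated at 0. The sample point 1/2 already gives at least
    \<open>3 / 2 * lam\<close>, by \<open>exp x \<ge> 1 + x\<close>.\<close>
  have "lam \<le> 3 / 2 * (lam / 2 + lam / 2)"
    using \<open>0 < lam\<close> by simp
  also have "\<dots> \<le> 3 / 2 * (exp (lam / 2) + lam / 2 - 1)"
    using exp_ge_add_one_self[of "lam / 2"] by (intro mult_left_mono) linarith+
  also have "\<dots> = bound_fun lam (1 / 2)"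
    by (simp add: bound_fun_def power2_eq_square)
  also have "\<dots> \<le> B"
    by (rule B) simp
  finally show ?thesis
    using True by simp
next
  case False
  then have "0 < s"
    using s by simp
  have "1 / r - r \<le> 1 / s - s"
    using \<open>0 < s\<close> s r by (intro diff_mono) (auto simp: field_simps)
  then have "(1 / r - r) * (exp (lam * s) - 1) \<le> (1 / s - s) * (exp (lam * s) - 1)"
    using \<open>0 < s\<close> \<open>0 < lam\<close> by (intro mult_right_mono) auto
  moreover have "(1 - r\<^sup>2) * ((exp (lam * s) - 1) / r) = (1 / r - r) * (exp (lam * s) - 1)"
    using r by (simp add: field_simps power2_eq_square)
  moreover have "(1 / s - s) * (exp (lam * s) - 1) + lam * (1 - s\<^sup>2) = bound_fun lam s"
    using \<open>0 < s\<close> by (simp add: bound_fun_def field_simps power2_eq_square)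
  ultimately have "(1 - r\<^sup>2) * ((exp (lam * s) - 1) / r) + lam * (1 - s\<^sup>2) \<le> bound_fun lam s"
    by linarith
  also have "\<dots> \<le> B"
    using \<open>0 < s\<close> s r by (intro B) simp
  finally show ?thesis .
qed

text \<open>Logarithmic differentiation of \<open>z f'(z) = f(z) exp (\<lambda> \<omega>(z))\<close>.\<close>

lemma pre_schwarzian_eq:
  assumes f: "f holomorphic_on unit_disc" and w: "\<omega> holomorphic_on unit_disc"
    and eq: "\<And>u. u \<in> unit_disc \<Longrightarrow> u \<noteq> 0 \<Longrightarrow> u * deriv f u / f u = exp (of_real lam * \<omega> u)"
    and z: "z \<in> unit_disc" "z \<noteq> 0"
  shows "pre_schwarzian f z = (exp (of_real lam * \<omega> z) - 1) / z + of_real lam * deriv \<omega> z"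
proof -
  define E where "E u = exp (of_real lam * \<omega> u)" for u
  have eq': "u * deriv f u = f u * E u" "f u \<noteq> 0" if "u \<in> unit_disc" "u \<noteq> 0" for u
  proof -
    \<comment> \<open>Division by 0 gives 0 in HOL, which is never an exponential.\<close>
    show "f u \<noteq> 0"
      using eq[OF that] by (metis div_by_0 exp_not_eq_zero)
    then show "u * deriv f u = f u * E u"
      using eq[OF that] by (simp add: E_def field_simps)
  qed
  have "((\<lambda>u. u * deriv f u) has_field_derivative deriv f z + z * deriv (deriv f) z) (at z)"
    by (rule derivative_eq_intros holomorphic_derivI[OF holomorphic_deriv[OF f]] refl | use z in simp)+
  then have 1: "deriv (\<lambda>u. u * deriv f u) z = deriv f z + z * deriv (deriv f) z"
    by (rule DERIV_imp_deriv)
  have "((\<lambda>u. f u * E u) has_field_derivative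
      deriv f z * E z + f z * (E z * (of_real lam * deriv \<omega> z))) (at z)"
    unfolding E_def
    by (rule derivative_eq_intros holomorphic_derivI[OF f] holomorphic_derivI[OF w] refl
        | use z in \<open>simp add: algebra_simps\<close>)+
  then have 2: "deriv (\<lambda>u. f u * E u) z =
      deriv f z * E z + f z * (E z * (of_real lam * deriv \<omega> z))"
    by (rule DERIV_imp_deriv)
  \<comment> \<open>The identity is available on the punctured disc, an open neighbourhood of
    \<open>z\<close>, so it may be differentiated at \<open>z\<close>.\<close>
  have "eventually (\<lambda>u. u \<in> unit_disc - {0}) (nhds z)"
    using z by (intro eventually_nhds_in_open) auto
  then have "deriv (\<lambda>u. u * deriv f u) z = deriv (\<lambda>u. f u * E u) z"
    by (intro deriv_cong_ev) (auto elim!: eventually_mono simp: eq')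
  \<comment> \<open>Replacing \<open>f z * E z\<close> by \<open>z * deriv f z\<close> eliminates
    \<open>f\<close>; dividing by \<open>z * deriv f z\<close> then gives the formula.\<close>
  with 1 2 have main: "deriv f z + z * deriv (deriv f) z =
      deriv f z * E z + z * deriv f z * (of_real lam * deriv \<omega> z)"
    using eq'[OF z] by (simp add: algebra_simps)
  have "deriv f z \<noteq> 0"
    using eq'[OF z] by (auto simp: E_def)
  with main z show ?thesis
    unfolding pre_schwarzian_def E_def[symmetric] by (simp add: field_simps)
qed

lemma pre_schwarzian_bound:
  assumes "0 < lam" and f: "f \<in> starlike_exp lam" and z: "z \<in> unit_disc"
    and B: "\<And>t. t \<in> {0<..<1} \<Longrightarrow> bound_fun lam t \<le> B"
  shows "(1 - (cmod z)\<^sup>2) * cmod (pre_schwarzian f z) \<le> B"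
proof -
  have holf: "f holomorphic_on unit_disc"
    using f by (simp add: starlike_exp_def class_A_def)
  obtain \<omega> where w: "\<omega> holomorphic_on unit_disc" "\<omega> ` unit_disc \<subseteq> unit_disc" "\<omega> 0 = 0"
    and w_eq: "\<forall>z\<in>unit_disc.
      (if z = 0 then 1 else z * deriv f z / f z) = exp (of_real lam * \<omega> z)"
    using f unfolding starlike_exp_def subordinate_def by blast
  define N where "N u = (1 - (cmod u)\<^sup>2) * cmod (pre_schwarzian f u)" for u
  have off_0: "N u \<le> B" if u: "u \<in> unit_disc" "u \<noteq> 0" for u
  proof -
    have nu: "0 < cmod u" "cmod u < 1"
      using u by auto
    then have pos: "0 < 1 - (cmod u)\<^sup>2"
      by (simp add: abs_square_less_1)
    have "cmod (exp (of_real lam * \<omega> u) - 1) \<le> exp (lam * cmod (\<omega> u)) - 1"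
      using norm_exp_minus_one_le[of "of_real lam * \<omega> u"] \<open>0 < lam\<close> by (simp add: norm_mult)
    then have "cmod ((exp (of_real lam * \<omega> u) - 1) / u) \<le> (exp (lam * cmod (\<omega> u)) - 1) / cmod u"
      using nu by (simp add: norm_divide divide_right_mono)
    moreover have "pre_schwarzian f u =
        (exp (of_real lam * \<omega> u) - 1) / u + of_real lam * deriv \<omega> u"
      using w_eq u by (intro pre_schwarzian_eq holf w) (auto split: if_splits)
    ultimately have "cmod (pre_schwarzian f u)
        \<le> (exp (lam * cmod (\<omega> u)) - 1) / cmod u + lam * cmod (deriv \<omega> u)"
      using \<open>0 < lam\<close> norm_triangle_ineq[of "(exp (of_real lam * \<omega> u) - 1) / u"
          "of_real lam * deriv \<omega> u"] by (simp add: norm_mult)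
    then have "N u \<le> (1 - (cmod u)\<^sup>2) *
        ((exp (lam * cmod (\<omega> u)) - 1) / cmod u + lam * cmod (deriv \<omega> u))"
      unfolding N_def using pos by (intro mult_left_mono) auto
    also have "\<dots> = (1 - (cmod u)\<^sup>2) * ((exp (lam * cmod (\<omega> u)) - 1) / cmod u)
        + lam * ((1 - (cmod u)\<^sup>2) * cmod (deriv \<omega> u))"
      by (simp only: distrib_left mult.left_commute)
    also have "\<dots> \<le> (1 - (cmod u)\<^sup>2) * ((exp (lam * cmod (\<omega> u)) - 1) / cmod u)
        + lam * (1 - (cmod (\<omega> u))\<^sup>2)"
      using Schwarz_Pick[OF w(1,2) u(1)] \<open>0 < lam\<close> by (intro add_left_mono mult_left_mono) auto
    also have "\<dots> \<le> B"
    proof (rule two_variable_bound[OF \<open>0 < lam\<close> _ _ nu B])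
      show "cmod (\<omega> u) \<le> cmod u"
        using w nu by (intro Schwarz_Lemma(1)) (auto simp: image_subset_iff)
    qed auto
    finally show ?thesis .
  qed
  show ?thesis
  proof (cases "z = 0")
    case True
    \<comment> \<open>The formula for the pre-Schwarzian divides by \<open>z\<close>, so the origin
      is treated as a limit; continuity there rests on \<open>deriv f 0 \<noteq> 0\<close>.\<close>
    have "isCont N 0"
      unfolding N_def pre_schwarzian_def
      using starlike_exp_nonzero(1)[OF f, of 0] holf
      by (intro continuous_intros holomorphic_on_imp_continuous_on[THEN continuous_on_interior]
          holomorphic_deriv) (auto intro!: holomorphic_deriv)
    then have "(N \<longlongrightarrow> N 0) (at 0)"
      by (simp add: isCont_def)
    moreover have "eventually (\<lambda>u. N u \<le> B) (at 0)"
      unfolding eventually_at by (rule exI[of _ 1]) (auto intro: off_0)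
    ultimately have "N 0 \<le> B"
      by (intro tendsto_upperbound) auto
    then show ?thesis
      by (simp add: N_def True)
  qed (use off_0 z in \<open>simp add: N_def\<close>)
qed

section \<open>The extremal function and sharpness\<close>

text \<open>The solution of \<open>z f'(z) / f(z) = exp (\<lambda> z)\<close> is \<open>z exp (\<integral> (exp (\<lambda> t) - 1) / t dt)\<close>.\<close>

lemma extremal_function_exists:
  obtains f where "f \<in> starlike_exp lam"
    "\<And>z. z \<in> unit_disc \<Longrightarrow> z \<noteq> 0 \<Longrightarrow>
       pre_schwarzian f z = (exp (of_real lam * z) - 1) / z + of_real lam"
proof -
  \<comment> \<open>The numerator of the integrand vanishes at 0, so a factor \<open>z\<close>
    splits off and the cofactor \<open>h\<close> is holomorphic on the whole disc.\<close>
  have "(\<lambda>z. exp (of_real lam * z) - 1) holomorphic_on unit_disc"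
    by (intro holomorphic_intros)
  moreover have "exp (of_real lam * 0) - 1 = (0::complex)"
    by simp
  ultimately obtain h where h: "h holomorphic_on unit_disc"
      and h_eq: "\<And>z. cmod z < 1 \<Longrightarrow> exp (of_real lam * z) - 1 = z * h z"
    using Schwarz3[where f = "\<lambda>z. exp (of_real lam * z) - 1" and r = 1] by metis
  obtain G where G: "\<And>z. z \<in> unit_disc \<Longrightarrow> (G has_field_derivative h z) (at z within unit_disc)"
    using holomorphic_convex_primitive'[OF _ _ h] by auto
  then have G': "(G has_field_derivative h z) (at z)" if "z \<in> unit_disc" for z
    using that by (metis at_within_open open_ball)
  \<comment> \<open>Subtracting \<open>G 0\<close> normalises the derivative at 0 to 1.\<close>
  define f where "f z = z * exp (G z - G 0)" for z
  have f': "(f has_field_derivative exp (of_real lam * z) * exp (G z - G 0)) (at z)"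
    if "z \<in> unit_disc" for z
  proof -
    have e: "exp (of_real lam * z) = 1 + z * h z"
      using h_eq[of z] that by (simp add: algebra_simps)
    show ?thesis
      unfolding f_def e by (rule derivative_eq_intros G' that refl)+ (simp add: algebra_simps)
  qed
  then have deriv_f: "deriv f z = exp (of_real lam * z) * exp (G z - G 0)" if "z \<in> unit_disc" for z
    using that DERIV_imp_deriv by blast
  have holf: "f holomorphic_on unit_disc"
    using f' unfolding holomorphic_on_open[OF open_ball] by blast
  have quot: "z * deriv f z / f z = exp (of_real lam * z)" if "z \<in> unit_disc" "z \<noteq> 0" for z
    using that by (simp add: deriv_f f_def)
  have "f \<in> class_A"
    using holf deriv_f[of 0] by (simp add: class_A_def f_def)
  moreover have "subordinate (\<lambda>z. if z = 0 then 1 else z * deriv f z / f z)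
                    (\<lambda>z. exp (of_real lam * z))"
    unfolding subordinate_def
  proof (intro conjI exI[of _ "\<lambda>z. z"] ballI)
    \<comment> \<open>The piecewise quotient agrees with this exponential on all of the disc, its
      value 1 at 0 included, and so inherits holomorphy.\<close>
    have "(\<lambda>z. exp (of_real lam * z)) holomorphic_on unit_disc"
      by (intro holomorphic_intros)
    then show "(\<lambda>z. if z = 0 then 1 else z * deriv f z / f z) holomorphic_on unit_disc"
      by (rule holomorphic_transform) (auto simp: quot)
  qed (use quot in \<open>auto intro!: holomorphic_intros\<close>)
  ultimately have "f \<in> starlike_exp lam"
    by (simp add: starlike_exp_def)
  moreover have "pre_schwarzian f z = (exp (of_real lam * z) - 1) / z + of_real lam"
    if "z \<in> unit_disc" "z \<noteq> 0" for z
    using pre_schwarzian_eq[where \<omega> = "\<lambda>z. z", OF holf _ quot that] by simp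
  ultimately show thesis
    using that by blast
qed

theorem theorem2p1:
  fixes lam :: real
  assumes "0 < lam" and "lam \<le> pi / 2"
  shows "\<exists>\<alpha>\<in>{0<..<1::real}.
           (\<forall>r\<in>{0<..<1::real}.
              1 + r^2 - 2 * lam * r^3 - exp (lam * r) * (1 - lam * r + r^2 + lam * r^3) = 0
                \<longleftrightarrow> r = \<alpha>) \<and>
           (\<forall>f\<in>starlike_exp lam.
              pre_schwarzian_norm f
                \<le> ereal ((1 - \<alpha>^2) * (exp (lam * \<alpha>) + lam * \<alpha> - 1) / \<alpha>)) \<and>
           (\<exists>f\<in>starlike_exp lam.
              pre_schwarzian_norm f
                = ereal ((1 - \<alpha>^2) * (exp (lam * \<alpha>) + lam * \<alpha> - 1) / \<alpha>))"
proof -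
  \<comment> \<open>The crude estimate \<open>pi < 4\<close> suffices for
    \<open>lam^2 \<le> 6\<close>.\<close>
  have "lam < 2"
    using assms(2) pi_less_4 by simp
  then have "lam^2 \<le> 2^2"
    using assms(1) by (intro power_mono) auto
  then have "lam^2 \<le> 6"
    by simp
  with assms(1) obtain \<alpha> where \<alpha>: "\<alpha> \<in> {0<..<1}"
    and root: "\<And>r. r \<in> {0<..<1} \<Longrightarrow> critical_fun lam r = 0 \<longleftrightarrow> r = \<alpha>"
    and max: "\<And>r. r \<in> {0<..<1} \<Longrightarrow> bound_fun lam r \<le> bound_fun lam \<alpha>"
    using critical_point by blast
  have upper: "pre_schwarzian_norm f \<le> ereal (bound_fun lam \<alpha>)" if "f \<in> starlike_exp lam" for f
    unfolding pre_schwarzian_norm_def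
    using pre_schwarzian_bound[OF assms(1) that _ max] by (intro SUP_least) simp
  obtain f where f: "f \<in> starlike_exp lam" and P: "\<And>z. z \<in> unit_disc \<Longrightarrow> z \<noteq> 0 \<Longrightarrow>
       pre_schwarzian f z = (exp (of_real lam * z) - 1) / z + of_real lam"
    by (rule extremal_function_exists[of lam]) blast
  \<comment> \<open>At the positive real point \<alpha> both summands are real and nonnegative, so
    no modulus is lost to the triangle inequality.\<close>
  have "pre_schwarzian f (of_real \<alpha>) = of_real ((exp (lam * \<alpha>) - 1) / \<alpha> + lam)"
    using P[of "of_real \<alpha>"] \<alpha> by (simp add: exp_of_real[symmetric])
  moreover have "0 \<le> (exp (lam * \<alpha>) - 1) / \<alpha> + lam"
    using \<alpha> assms(1) by simp
  ultimately have cmod_P: "cmod (pre_schwarzian f (of_real \<alpha>)) = (exp (lam * \<alpha>) - 1) / \<alpha> + lam"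
    by (simp only: norm_of_real abs_of_nonneg)
  have "(1 - (cmod (of_real \<alpha>))\<^sup>2) * cmod (pre_schwarzian f (of_real \<alpha>)) = bound_fun lam \<alpha>"
    unfolding cmod_P using \<alpha> by (simp add: bound_fun_def field_simps)
  then have "ereal (bound_fun lam \<alpha>) \<le> pre_schwarzian_norm f"
    unfolding pre_schwarzian_norm_def using \<alpha> by (intro SUP_upper2[of "of_real \<alpha>"]) auto
  with upper[OF f] have "pre_schwarzian_norm f = ereal (bound_fun lam \<alpha>)"
    by (rule antisym)
  with f upper root \<alpha> show ?thesis
    unfolding bound_fun_def critical_fun_def by blast
qed

end
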